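(* Let $n>2$ and let $m_1>m_2>\cdots>m_n>0$ and $1+r>0$ be real numbers. Suppose $m_{s-1}>1+r\ge m_s$ for some $s\in\{2,\ldots,n\}$ and $1+r\neq m_n$, and let $I=\{1,\ldots,s-1\}$ and $J=\{s,\ldots,n\}$. Let $\mathcal{Q}$ be the set of equivalent martingale measures of the one-period $n$-nomial market model with parameters $m_1,\ldots,m_n$ and $1+r$, and let $\underline{Q}(A)=\min_{Q\in\mathrm{cl}(\mathcal{Q})}Q(A)$ for $A\subseteq\{1,\ldots,n\}$. Then, for every $A\subseteq\Omega=\{1,\ldots,n\}$, $$\underline{Q}(A)=\begin{cases} 1 & \text{if } A=\Omega,\\[1ex] \dfrac{(1+r)-m_{\underline{j}}}{m_1-m_{\underline{j}}} & \text{if } 1+r\neq m_s \text{ and } I\subseteq A\neq\Omega,\ \text{or } 1+r=m_s \text{ and } I\cup\{s\}\subseteq A\neq\Omega,\\[2ex] \dfrac{m_{\overline{i}}-(1+r)}{m_{\overline{i}}-m_n} & \text{if } J\subseteq A\neq\Omega,\\[2ex] 0 & \text{otherwise}, \end{cases}$$ where $\underline{j}=\min\{j\in J: j\notin A\}$ (used in the second case) and $\overline{i}=\max\{i\in I: i\notin A\}$ (used in the third case).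
   Context: One-period $n$-nomial market model: $\Omega=\{1,\ldots,n\}$, $\mathcal{F}$ is the power set of $\Omega$, and $P$ is a probability measure on $\mathcal{F}$ with $P(\{i\})>0$ for all $i\in\Omega$. There is a risk-free asset with $B_0=1$, $B_1=1+r>0$, and a risky asset with price $S_0>0$ at time $0$ and price $S_1(i)=m_iS_0$, $i\in\Omega$, at time $1$, where $m_1>\cdots>m_n>0$. The set of equivalent martingale measures is $$\mathcal{Q}=\{Q \text{ probability measure on }\mathcal{F}\,:\,(1+r)^{-1}\mathbb{E}_Q(S_1)=S_0,\ Q\sim P\},$$ where $Q\sim P$ means that $Q$ and $P$ have the same null sets (i.e. $Q(\{i\})>0$ for all $i$). Identifying a probability measure with the vector $(Q(\{1\}),\ldots,Q(\{n\}))^T$, $\mathrm{cl}(\mathcal{Q})$ denotes the closure of $\mathcal{Q}$ in $\mathbb{R}^n$. *)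

theory Defs
  imports "HOL-Probability.Probability"
begin

definition nnomial_price :: "real \<Rightarrow> (nat \<Rightarrow> real) \<Rightarrow> nat \<Rightarrow> real" where
  "nnomial_price S0 m i = m i * S0"

definition equiv_martingale_measures ::
    "'a measure \<Rightarrow> real \<Rightarrow> real \<Rightarrow> ('a \<Rightarrow> real) \<Rightarrow> 'a measure set" where
  "equiv_martingale_measures P r S0 S1 =
     {Q. prob_space Q \<and> sets Q = sets P \<and>
         inverse (1 + r) * (\<integral>\<omega>. S1 \<omega> \<partial>Q) = S0 \<and>
         null_sets Q = null_sets P}"

text \<open>The space \<open>\<real>\<^sup>n\<close> is rendered as \<open>powertop_real {1..n}\<close>, whose points are the functions
  on \<open>{1..n}\<close> made total by the value \<open>undefined\<close> elsewhere; hence the \<open>restrict\<close>.\<close>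

definition prob_vector :: "nat \<Rightarrow> nat measure \<Rightarrow> nat \<Rightarrow> real" where
  "prob_vector n Q = (\<lambda>i\<in>{1..n}. measure Q {i})"

definition cl_measures :: "nat \<Rightarrow> nat measure set \<Rightarrow> (nat \<Rightarrow> real) set" where
  "cl_measures n \<Q> = powertop_real {1..n} closure_of (prob_vector n ` \<Q>)"

definition event_prob :: "(nat \<Rightarrow> real) \<Rightarrow> nat set \<Rightarrow> real" where
  "event_prob q A = (\<Sum>i\<in>A. q i)"

lemma event_prob_prob_vector:
  assumes "prob_space Q" "sets Q = Pow {1..n}" "A \<subseteq> {1..n}"
  shows "event_prob (prob_vector n Q) A = measure Q A"
proof -
  interpret prob_space Q by fact
  have "finite A" using assms(3) finite_subset by blast
  then have "measure Q A = (\<Sum>i\<in>A. measure Q {i})"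
    using assms by (intro finite_measure_eq_sum_singleton) auto
  also have "\<dots> = (\<Sum>i\<in>A. prob_vector n Q i)"
    using assms(3) by (intro sum.cong) (auto simp: prob_vector_def)
  finally show ?thesis by (simp add: event_prob_def)
qed

text \<open>\<open>LEAST\<close> is the minimum of the set of values, provided the minimum is attained
  (it is unspecified otherwise).\<close>

definition lower_prob :: "(nat \<Rightarrow> real) set \<Rightarrow> nat set \<Rightarrow> real" where
  "lower_prob C A = (LEAST v. v \<in> (\<lambda>q. event_prob q A) ` C)"

end

theory Submission imports Defs begin

text \<open>The closure of the set of equivalent martingale measures is the polytope of all probability
  vectors \<open>q\<close> with \<open>\<Sum>i. q i * m i = 1 + r\<close>. On this polytope \<open>q(A)\<close> is bounded below by
  estimating \<open>m\<close> by its extreme values on \<open>A\<close> and on the complement of \<open>A\<close>, and the bound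
  is attained at the vector concentrated on the two corresponding states.\<close>

definition martingale_vectors :: "nat \<Rightarrow> (nat \<Rightarrow> real) \<Rightarrow> real \<Rightarrow> (nat \<Rightarrow> real) set" where
  "martingale_vectors n m c =
     {q \<in> extensional {1..n}. (\<forall>i\<in>{1..n}. 0 \<le> q i) \<and> (\<Sum>i=1..n. q i) = 1 \<and>
        (\<Sum>i=1..n. q i * m i) = c}"

section \<open>Vectors concentrated on two states\<close>

text \<open>If \<open>m a\<close> and \<open>m b\<close> differ, the two weights are the unique
  solution of \<open>x + y = 1\<close> and \<open>x * m a + y * m b = c\<close>. The two indicator
  terms are added, not nested, so that a sum over any finite event separates into two one-point
  sums.\<close>

definition two_point_vector :: "nat \<Rightarrow> (nat \<Rightarrow> real) \<Rightarrow> real \<Rightarrow> nat \<Rightarrow> nat \<Rightarrow> nat \<Rightarrow> real" where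
  "two_point_vector n m c a b =
     (\<lambda>i\<in>{1..n}. (if i = a then (c - m b) / (m a - m b) else 0) +
                 (if i = b then (m a - c) / (m a - m b) else 0))"

lemma event_prob_two_point_vector:
  assumes "A \<subseteq> {1..n}"
  shows "event_prob (two_point_vector n m c a b) A =
    (if a \<in> A then (c - m b) / (m a - m b) else 0) + (if b \<in> A then (m a - c) / (m a - m b) else 0)"
proof -
  have "finite A" using assms finite_subset by blast
  have "event_prob (two_point_vector n m c a b) A =
      (\<Sum>i\<in>A. (if i = a then (c - m b) / (m a - m b) else 0) +
              (if i = b then (m a - c) / (m a - m b) else 0))"
    unfolding event_prob_def two_point_vector_def using assms by (intro sum.cong) auto
  then show ?thesis using \<open>finite A\<close> by (simp add: sum.distrib)
qed

lemma two_point_vector_in_martingale_vectors: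
  assumes "a \<in> {1..n}" "b \<in> {1..n}" "m b \<le> c" "c \<le> m a" "m b < m a"
  shows "two_point_vector n m c a b \<in> martingale_vectors n m c"
proof -
  let ?x = "(c - m b) / (m a - m b)" and ?y = "(m a - c) / (m a - m b)"
  have "?x * m a + ?y * m b = c * (m a - m b) / (m a - m b)"
    by (simp add: add_divide_distrib[symmetric] algebra_simps)
  then have xy: "?x * m a + ?y * m b = c" using assms(5) by simp
  have "?x + ?y = 1"
    using assms(5) by (simp add: add_divide_distrib[symmetric])
  then have "(\<Sum>i=1..n. two_point_vector n m c a b i) = 1"
    using event_prob_two_point_vector[of "{1..n}" n m c a b] assms by (simp add: event_prob_def)
  moreover have "(\<Sum>i=1..n. two_point_vector n m c a b i * m i) = c"
  proof -
    have "(\<Sum>i=1..n. two_point_vector n m c a b i * m i) =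
        (\<Sum>i=1..n. (if i = a then ?x * m a else 0) + (if i = b then ?y * m b else 0))"
      unfolding two_point_vector_def by (intro sum.cong) (auto simp: algebra_simps)
    also have "\<dots> = ?x * m a + ?y * m b"
      using assms by (simp add: sum.distrib)
    finally show ?thesis using xy by simp
  qed
  ultimately show ?thesis
    using assms unfolding martingale_vectors_def by (auto simp: two_point_vector_def)
qed

section \<open>Lower bounds for the probability of an event\<close>

text \<open>Splitting the mean \<open>c\<close> over \<open>A\<close> and its complement gives
  \<open>c \<le> q(A) * u + (1 - q(A)) * l\<close>, which is solved for \<open>q(A)\<close>.
  Equality holds when \<open>q\<close> charges only states of \<open>A\<close> with
  \<open>m = u\<close> and states outside \<open>A\<close> with \<open>m = l\<close>.\<close>

lemma event_prob_ge_upper: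
  assumes q: "q \<in> martingale_vectors n m c" and A: "A \<subseteq> {1..n}" and "l < u"
    and u: "\<And>i. i \<in> A \<Longrightarrow> m i \<le> u" and l: "\<And>i. i \<in> {1..n} - A \<Longrightarrow> m i \<le> l"
  shows "(c - l) / (u - l) \<le> event_prob q A"
proof -
  have q0: "\<And>i. i \<in> {1..n} \<Longrightarrow> 0 \<le> q i" and q1: "(\<Sum>i=1..n. q i) = 1"
    and qm: "(\<Sum>i=1..n. q i * m i) = c"
    using q by (auto simp: martingale_vectors_def)
  have split: "(\<Sum>i=1..n. f i) = (\<Sum>i\<in>{1..n} - A. f i) + (\<Sum>i\<in>A. f i)" for f :: "nat \<Rightarrow> real"
    using sum.subset_diff[OF A] by simp
  have "(\<Sum>i\<in>A. q i * m i) \<le> (\<Sum>i\<in>A. q i * u)"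
    using A q0 u by (intro sum_mono mult_left_mono) auto
  moreover have "(\<Sum>i\<in>{1..n} - A. q i * m i) \<le> (\<Sum>i\<in>{1..n} - A. q i * l)"
    using q0 l by (intro sum_mono mult_left_mono) auto
  moreover have "(\<Sum>i\<in>{1..n} - A. q i) = 1 - event_prob q A"
    using split[of q] q1 by (simp add: event_prob_def)
  ultimately have "c \<le> (1 - event_prob q A) * l + event_prob q A * u"
    using split[of "\<lambda>i. q i * m i"] qm
    by (simp add: sum_distrib_right[symmetric] event_prob_def)
  then show ?thesis using \<open>l < u\<close> by (simp add: field_simps)
qed

text \<open>Replacing \<open>m\<close> and \<open>c\<close> by their negatives turns lower bounds on
  \<open>m\<close> into upper bounds, so the previous estimate applies with \<open>- u\<close> off
  \<open>A\<close> and \<open>- l\<close> on \<open>A\<close>.\<close>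

lemma event_prob_ge_lower:
  assumes q: "q \<in> martingale_vectors n m c" and A: "A \<subseteq> {1..n}" and "l < u"
    and "\<And>i. i \<in> A \<Longrightarrow> l \<le> m i" and "\<And>i. i \<in> {1..n} - A \<Longrightarrow> u \<le> m i"
  shows "(u - c) / (u - l) \<le> event_prob q A"
proof -
  have "q \<in> martingale_vectors n (\<lambda>i. - m i) (- c)"
    using q by (simp add: martingale_vectors_def sum_negf)
  from event_prob_ge_upper[OF this A, of "- u" "- l"] assms show ?thesis by simp
qed

section \<open>Closedness of the polytope and an interior point\<close>

lemma closedin_martingale_vectors:
  "closedin (powertop_real {1..n}) (martingale_vectors n m c)"
proof -
  let ?X = "powertop_real {1..n}"
  let ?N = "\<lambda>i. {q \<in> topspace ?X. q i \<in> {0..}}"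
  \<comment> \<open>Each factor is the preimage of a closed set under a coordinate projection or a
    finite sum of such. The leading \<open>topspace ?X\<close> keeps the set inside the space when
    \<open>n = 0\<close>, where the indexed intersection is \<open>UNIV\<close>.\<close>
  have "martingale_vectors n m c =
      (topspace ?X \<inter> (\<Inter>i\<in>{1..n}. ?N i)) \<inter>
      ({q \<in> topspace ?X. (\<Sum>i=1..n. q i) \<in> {1}} \<inter>
       {q \<in> topspace ?X. (\<Sum>i=1..n. q i * m i) \<in> {c}})"
    by (auto simp: martingale_vectors_def PiE_def)
  moreover have "closedin ?X (?N i)" if "i \<in> {1..n}" for i
    using that by (intro closedin_continuous_map_preimage[where Y = euclideanreal]
        continuous_map_product_projection) auto
  then have "closedin ?X (topspace ?X \<inter> (\<Inter>i\<in>{1..n}. ?N i))"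
    by (cases "n = 0") (auto simp del: topspace_product_topology intro!: closedin_Int)
  moreover have "closedin ?X {q \<in> topspace ?X. (\<Sum>i=1..n. q i) \<in> {1}}"
    by (intro closedin_continuous_map_preimage[where Y = euclideanreal]
        continuous_map_sum continuous_map_product_projection) auto
  moreover have "closedin ?X {q \<in> topspace ?X. (\<Sum>i=1..n. q i * m i) \<in> {c}}"
    by (intro closedin_continuous_map_preimage[where Y = euclideanreal]
        continuous_map_sum continuous_map_real_mult continuous_map_product_projection) auto
  ultimately show ?thesis
    by (metis (no_types, lifting) closedin_Int)
qed

text \<open>Every state \<open>k\<close> is charged by some two-point vector: its partner is state 1
  if \<open>m k < c\<close> and state \<open>n\<close> otherwise, and the strict bounds on
  \<open>c\<close> make the weight at \<open>k\<close> positive. Averaging these vectors over all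
  \<open>k\<close> makes every coordinate positive and preserves mass and mean.\<close>

lemma exists_positive_martingale_vector:
  assumes "strict_antimono_on {1..n} m" "m n < c" "c < m 1" "n > 0"
  shows "\<exists>p\<in>martingale_vectors n m c. \<forall>i\<in>{1..n}. 0 < p i"
proof -
  have "\<exists>v\<in>martingale_vectors n m c. 0 < v k" if k: "k \<in> {1..n}" for k
  proof (cases "m k < c")
    case True
    then have "two_point_vector n m c 1 k \<in> martingale_vectors n m c"
      using assms k by (intro two_point_vector_in_martingale_vectors) auto
    moreover have "0 < two_point_vector n m c 1 k k"
      using True assms k by (auto simp: two_point_vector_def)
    ultimately show ?thesis by blast
  next
    case False
    then have "two_point_vector n m c k n \<in> martingale_vectors n m c"
      using assms k by (intro two_point_vector_in_martingale_vectors) auto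
    moreover have "0 < two_point_vector n m c k n k"
      using False assms k by (auto simp: two_point_vector_def)
    ultimately show ?thesis by blast
  qed
  then obtain v where v: "\<And>k. k \<in> {1..n} \<Longrightarrow> v k \<in> martingale_vectors n m c"
    and vpos: "\<And>k. k \<in> {1..n} \<Longrightarrow> 0 < v k k"
    by metis
  define p where "p = (\<lambda>i\<in>{1..n}. (\<Sum>k=1..n. v k i) / n)"
  have v0: "\<And>k i. k \<in> {1..n} \<Longrightarrow> i \<in> {1..n} \<Longrightarrow> 0 \<le> v k i"
    and v1: "\<And>k. k \<in> {1..n} \<Longrightarrow> (\<Sum>i=1..n. v k i) = 1"
    and vm: "\<And>k. k \<in> {1..n} \<Longrightarrow> (\<Sum>i=1..n. v k i * m i) = c"
    using v by (auto simp: martingale_vectors_def)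
  have pos: "0 < p i" if "i \<in> {1..n}" for i
  proof -
    have "0 < (\<Sum>k=1..n. v k i)"
      using that v0 vpos by (intro sum_pos2[of _ i]) auto
    then show ?thesis using that \<open>n > 0\<close> by (simp add: p_def)
  qed
  have "(\<Sum>i=1..n. p i) = (\<Sum>i=1..n. \<Sum>k=1..n. v k i) / n"
    by (simp add: p_def sum_divide_distrib)
  also have "(\<Sum>i=1..n. \<Sum>k=1..n. v k i) = n"
    by (subst sum.swap) (use v1 in simp)
  finally have p1: "(\<Sum>i=1..n. p i) = 1" using \<open>n > 0\<close> by simp
  have "(\<Sum>i=1..n. p i * m i) = (\<Sum>i=1..n. \<Sum>k=1..n. v k i * m i) / n"
    by (simp add: p_def sum_divide_distrib sum_distrib_right)
  also have "(\<Sum>i=1..n. \<Sum>k=1..n. v k i * m i) = n * c"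
    by (subst sum.swap) (use vm in simp)
  finally have "(\<Sum>i=1..n. p i * m i) = c" using \<open>n > 0\<close> by simp
  then have "p \<in> martingale_vectors n m c"
    using p1 pos by (auto simp: martingale_vectors_def p_def less_imp_le)
  with pos show ?thesis by blast
qed

section \<open>From martingale measures to vectors\<close>

lemma integral_finite_Pow:
  fixes f :: "'a \<Rightarrow> real"
  assumes "prob_space Q" "sets Q = Pow A" "finite A"
  shows "(\<integral>\<omega>. f \<omega> \<partial>Q) = (\<Sum>i\<in>A. measure Q {i} * f i)"
proof -
  interpret prob_space Q by fact
  have "Q = point_measure A (\<lambda>i. ennreal (measure Q {i}))"
    using assms by (intro measure_eqI_finite[of _ A])
      (auto simp: sets_point_measure emeasure_point_measure_finite emeasure_eq_measure)
  then have "(\<integral>\<omega>. f \<omega> \<partial>Q) = (\<integral>\<omega>. f \<omega> \<partial>point_measure A (\<lambda>i. ennreal (measure Q {i})))"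
    by simp
  also have "\<dots> = (\<Sum>i\<in>A. measure Q {i} * f i)"
    using \<open>finite A\<close> by (subst lebesgue_integral_point_measure_finite) auto
  finally show ?thesis .
qed

text \<open>A nonempty null set would contain a null singleton. Equivalence with a measure charging
  every state thereby becomes strict positivity of all coordinates.\<close>

lemma null_sets_Pow_eq_empty_iff:
  assumes "prob_space Q" "sets Q = Pow A"
  shows "null_sets Q = {{}} \<longleftrightarrow> (\<forall>i\<in>A. 0 < measure Q {i})"
proof -
  interpret prob_space Q by fact
  have null: "{i} \<in> null_sets Q \<longleftrightarrow> \<not> 0 < measure Q {i}" if "i \<in> A" for i
    using that assms(2) by (auto simp: null_sets_def emeasure_eq_measure zero_less_measure_iff)
  show ?thesis
  proof
    assume "null_sets Q = {{}}"
    then show "\<forall>i\<in>A. 0 < measure Q {i}" using null by blast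
  next
    assume pos: "\<forall>i\<in>A. 0 < measure Q {i}"
    have "X = {}" if X: "X \<in> null_sets Q" for X
    proof (rule ccontr)
      assume "X \<noteq> {}"
      then obtain i where "i \<in> X" by blast
      moreover have "X \<subseteq> A" using X assms(2) by (auto simp: null_sets_def)
      ultimately have "{i} \<in> null_sets Q"
        using null_sets_subset[OF X, of "{i}"] assms(2) by auto
      then show False using null pos \<open>i \<in> X\<close> \<open>X \<subseteq> A\<close> by blast
    qed
    then show "null_sets Q = {{}}" by auto
  qed
qed

text \<open>The price is linear in \<open>S0\<close>, so \<open>S0 > 0\<close> cancels and the
  martingale condition says that \<open>m\<close> has mean \<open>1 + r\<close>. Conversely, a
  positive vector of mass one is realised by the point measure with its coordinates as
  weights.\<close>

lemma prob_vector_equiv_martingale_measures: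
  assumes P: "prob_space P" "sets P = Pow {1..n}" "\<forall>i\<in>{1..n}. 0 < measure P {i}"
    and "S0 > 0" "1 + r > 0"
  shows "prob_vector n ` equiv_martingale_measures P r S0 (nnomial_price S0 m) =
    {q \<in> martingale_vectors n m (1 + r). \<forall>i\<in>{1..n}. 0 < q i}" (is "?L = ?R")
proof -
  have null_P: "null_sets P = {{}}" using null_sets_Pow_eq_empty_iff P by blast
  have price: "inverse (1 + r) * (\<integral>\<omega>. nnomial_price S0 m \<omega> \<partial>Q) = S0 \<longleftrightarrow>
      (\<Sum>i=1..n. measure Q {i} * m i) = 1 + r"
    if "prob_space Q" "sets Q = Pow {1..n}" for Q
  proof -
    have "(\<integral>\<omega>. nnomial_price S0 m \<omega> \<partial>Q) = (\<Sum>i=1..n. measure Q {i} * m i) * S0"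
      by (subst integral_finite_Pow[OF that])
        (simp_all add: nnomial_price_def sum_distrib_right mult.assoc)
    then have "inverse (1 + r) * (\<integral>\<omega>. nnomial_price S0 m \<omega> \<partial>Q) = S0 \<longleftrightarrow>
        (\<Sum>i=1..n. measure Q {i} * m i) * S0 = (1 + r) * S0"
      using assms(5) by (simp add: inverse_eq_divide divide_eq_eq mult.commute)
    then show ?thesis using assms(4) by simp
  qed
  have "?L \<subseteq> ?R"
  proof
    fix q assume "q \<in> ?L"
    then obtain Q where q: "q = prob_vector n Q" and Q: "prob_space Q" "sets Q = Pow {1..n}"
      and mart: "inverse (1 + r) * (\<integral>\<omega>. nnomial_price S0 m \<omega> \<partial>Q) = S0"
      and null: "null_sets Q = {{}}"
      using P null_P by (auto simp: equiv_martingale_measures_def)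
    interpret prob_space Q by fact
    have "\<forall>i\<in>{1..n}. 0 < q i"
      using null null_sets_Pow_eq_empty_iff[OF Q] by (simp add: q prob_vector_def)
    \<comment> \<open>Comparing the sigma-algebra of \<open>Q\<close> with that of
      \<open>count_space {1..n}\<close> identifies \<open>space Q\<close> as \<open>{1..n}\<close>,
      whose measure is 1.\<close>
    moreover have "(\<Sum>i=1..n. q i) = 1"
      using event_prob_prob_vector[OF Q, of "{1..n}"] prob_space
        sets_eq_imp_space_eq[of Q "count_space {1..n}"] Q
      by (simp add: event_prob_def q)
    moreover have "(\<Sum>i=1..n. q i * m i) = 1 + r"
      using price[OF Q] mart by (simp add: q prob_vector_def)
    ultimately show "q \<in> ?R"
      by (auto simp: martingale_vectors_def q prob_vector_def less_imp_le)
  qed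
  moreover have "?R \<subseteq> ?L"
  proof
    fix q assume "q \<in> ?R"
    then have ext: "q \<in> extensional {1..n}" and pos: "\<And>i. i \<in> {1..n} \<Longrightarrow> 0 < q i"
      and q1: "(\<Sum>i=1..n. q i) = 1" and qm: "(\<Sum>i=1..n. q i * m i) = 1 + r"
      by (auto simp: martingale_vectors_def)
    define Q where "Q = point_measure {1..n} (\<lambda>i. ennreal (q i))"
    have sets: "sets Q = Pow {1..n}" by (simp add: Q_def sets_point_measure)
    have Q: "prob_space Q"
      unfolding Q_def
    proof (rule prob_space_point_measure)
      have "(\<Sum>i=1..n. ennreal (q i)) = ennreal (\<Sum>i=1..n. q i)"
        using pos by (intro sum_ennreal) (auto simp: less_imp_le)
      then show "(\<Sum>i=1..n. ennreal (q i)) = 1" using q1 by simp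
    qed auto
    have meas: "measure Q {i} = q i" if "i \<in> {1..n}" for i
      using that pos[OF that] by (simp add: Q_def measure_def emeasure_point_measure_finite)
    have "null_sets Q = {{}}"
      using null_sets_Pow_eq_empty_iff[OF Q sets] meas pos by simp
    moreover have "inverse (1 + r) * (\<integral>\<omega>. nnomial_price S0 m \<omega> \<partial>Q) = S0"
      using price[OF Q sets] meas qm by simp
    ultimately have "Q \<in> equiv_martingale_measures P r S0 (nnomial_price S0 m)"
      using Q sets P null_P by (simp add: equiv_martingale_measures_def)
    moreover have "q = prob_vector n Q"
      using ext meas by (intro extensionalityI[of _ "{1..n}"]) (auto simp: prob_vector_def)
    ultimately show "q \<in> ?L" by blast
  qed
  ultimately show ?thesis by blast
qed

section \<open>The closure of the positive vectors\<close>

text \<open>The polytope is closed and convex. The open segment from any of its points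
  \<open>q\<close> to the strictly positive \<open>p\<close> consists of strictly positive vectors
  and accumulates at \<open>q\<close>.\<close>

lemma closure_of_positive_martingale_vectors:
  assumes p: "p \<in> martingale_vectors n m c" "\<forall>i\<in>{1..n}. 0 < p i"
  shows "powertop_real {1..n} closure_of {q \<in> martingale_vectors n m c. \<forall>i\<in>{1..n}. 0 < q i} =
    martingale_vectors n m c" (is "?X closure_of ?R = ?K")
proof
  show "?X closure_of ?R \<subseteq> ?K"
    by (intro closure_of_minimal closedin_martingale_vectors) auto
  show "?K \<subseteq> ?X closure_of ?R"
  proof
    fix q assume q: "q \<in> ?K"
    define f where "f = (\<lambda>t::real. \<lambda>i\<in>{1..n}. q i + t * (p i - q i))"
    have "continuous_map euclideanreal ?X f"
      unfolding continuous_map_componentwise f_def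
      by (auto simp: continuous_map_iff_continuous2 intro!: continuous_intros)
    \<comment> \<open>The parameter 0 gives \<open>q\<close> itself, which may have zero
      coordinates, so it is reached only through the closure of the open interval.\<close>
    then have "f ` closure {0<..<1} \<subseteq> ?X closure_of f ` {0<..<1}"
      using continuous_map_image_closure_subset by fastforce
    then have "f 0 \<in> ?X closure_of f ` {0<..<1}"
      by auto
    moreover have "f 0 = q"
      using q by (auto simp: f_def martingale_vectors_def extensional_def fun_eq_iff)
    moreover have "f ` {0<..<1} \<subseteq> ?R"
    proof safe
      fix t :: real assume t: "t \<in> {0<..<1}"
      have pos: "0 < f t i" if "i \<in> {1..n}" for i
      proof -
        have "0 < t * p i" "0 \<le> (1 - t) * q i"
          using t p(2) q that by (auto simp: martingale_vectors_def)
        then show ?thesis using that by (simp add: f_def algebra_simps)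
      qed
      then show "\<And>i. i \<in> {1..n} \<Longrightarrow> 0 < f t i" .
      have "(\<Sum>i=1..n. f t i) = (\<Sum>i=1..n. q i) + t * ((\<Sum>i=1..n. p i) - (\<Sum>i=1..n. q i))"
        by (simp add: f_def sum.distrib sum_distrib_left[symmetric] sum_subtractf)
      moreover have "(\<Sum>i=1..n. f t i * m i) =
          (\<Sum>i=1..n. q i * m i + t * (p i * m i - q i * m i))"
        by (intro sum.cong) (auto simp: f_def algebra_simps)
      then have "(\<Sum>i=1..n. f t i * m i) = (\<Sum>i=1..n. q i * m i) +
          t * ((\<Sum>i=1..n. p i * m i) - (\<Sum>i=1..n. q i * m i))"
        by (simp add: sum.distrib sum_distrib_left[symmetric] sum_subtractf)
      ultimately show "f t \<in> ?K"
        using p(1) q pos by (auto simp: martingale_vectors_def less_imp_le f_def)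
    qed
    ultimately show "q \<in> ?X closure_of ?R"
      using closure_of_mono by blast
  qed
qed

section \<open>The four cases of the lower probability\<close>

theorem theorem2:
  fixes n s :: nat and m :: "nat \<Rightarrow> real" and r S0 :: real
    and P :: "nat measure" and \<Omega> I J A :: "nat set"
  assumes "n > 2"
    and "\<Omega> = {1..n}"
    and "prob_space P" and "sets P = Pow \<Omega>" and "\<forall>i\<in>\<Omega>. measure P {i} > 0"
    and "S0 > 0"
    and "strict_antimono_on {1..n} m" and "m n > 0"
    and "1 + r > 0"
    and "s \<in> {2..n}" and "m (s - 1) > 1 + r" and "1 + r \<ge> m s"
    and "1 + r \<noteq> m n"
    and "I = {1..s - 1}" and "J = {s..n}"
    and "\<Q> = equiv_martingale_measures P r S0 (nnomial_price S0 m)"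
    and "A \<subseteq> \<Omega>"
  shows "(\<exists>q. is_arg_min (\<lambda>q. event_prob q A) (\<lambda>q. q \<in> cl_measures n \<Q>) q) \<and>
    lower_prob (cl_measures n \<Q>) A =
      (if A = \<Omega> then 1
       else if 1 + r \<noteq> m s \<and> I \<subseteq> A \<or> 1 + r = m s \<and> I \<union> {s} \<subseteq> A then
         (let j = Min {j \<in> J. j \<notin> A} in ((1 + r) - m j) / (m 1 - m j))
       else if J \<subseteq> A then
         (let i = Max {i \<in> I. i \<notin> A} in (m i - (1 + r)) / (m i - m n))
       else 0)"
proof -
  define c where "c = 1 + r"
  have P: "prob_space P" "sets P = Pow {1..n}" "\<forall>i\<in>{1..n}. 0 < measure P {i}"
    and A: "A \<subseteq> {1..n}"
    using assms by auto
  have m_less: "m j < m i" if "i < j" "i \<in> {1..n}" "j \<in> {1..n}" for i j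
    using assms(7) that by (auto simp: monotone_on_def)
  have m_le: "m j \<le> m i" if "i \<le> j" "i \<in> {1..n}" "j \<in> {1..n}" for i j
    using m_less[of i j] that by (cases "i = j") auto
  have s: "s \<in> {2..n}" and cs: "m s \<le> c" "c < m (s - 1)" and "n > 2"
    using assms by (auto simp: c_def)
  have I_gt: "c < m i" if "i \<in> I" for i
    using m_le[of i "s - 1"] cs s that assms(14) by force
  have J_le: "m j \<le> c" if "j \<in> J" for j
    using m_le[of s j] cs s that assms(15) by force
  have IJ: "I \<union> J = {1..n}" and I_less_J: "\<And>i j. i \<in> I \<Longrightarrow> j \<in> J \<Longrightarrow> i < j"
    using s assms(14,15) by auto
  have "1 \<in> I" "n \<in> J" "s \<in> J" using s assms(14,15) by auto
  \<comment> \<open>Strictness matters here: with \<open>c = m n\<close> all mass would have to sit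
    on state \<open>n\<close>, and no strictly positive vector would exist.\<close>
  have cn: "m n < c" using J_le[OF \<open>n \<in> J\<close>] assms(13) by (simp add: c_def)
  have c1: "c < m 1" using I_gt[OF \<open>1 \<in> I\<close>] .
  obtain p where p: "p \<in> martingale_vectors n m c" "\<forall>i\<in>{1..n}. 0 < p i"
    using exists_positive_martingale_vector[OF assms(7) cn c1] \<open>n > 2\<close> by auto
  have cl: "cl_measures n \<Q> = martingale_vectors n m c"
    using closure_of_positive_martingale_vectors[OF p]
      prob_vector_equiv_martingale_measures[OF P \<open>S0 > 0\<close> \<open>1 + r > 0\<close>, of m]
    by (simp add: cl_measures_def assms(16) c_def)
  \<comment> \<open>A lower bound \<open>v\<close> that is attained at some vector of the polytope
    yields both the existence of a minimiser and the value of \<open>LEAST\<close>; each case below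
    only supplies such a vector and bound.\<close>
  have attained: "(\<exists>q. is_arg_min (\<lambda>q. event_prob q A) (\<lambda>q. q \<in> cl_measures n \<Q>) q) \<and>
      lower_prob (cl_measures n \<Q>) A = v"
    if q: "q \<in> martingale_vectors n m c" "event_prob q A = v"
      and v: "\<And>q'. q' \<in> martingale_vectors n m c \<Longrightarrow> v \<le> event_prob q' A" for q v
  proof
    show "\<exists>q. is_arg_min (\<lambda>q. event_prob q A) (\<lambda>q. q \<in> cl_measures n \<Q>) q"
      unfolding is_arg_min_def cl using q v by (intro exI[of _ q]) (auto simp: not_less)
    show "lower_prob (cl_measures n \<Q>) A = v"
      unfolding lower_prob_def cl using q v by (intro Least_equality) auto
  qed
  have two_point: "two_point_vector n m c i j \<in> martingale_vectors n m c" if "i \<in> I" "j \<in> J" for i j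
  proof (rule two_point_vector_in_martingale_vectors)
    show "i \<in> {1..n}" "j \<in> {1..n}" using that IJ by blast+
    show "m j \<le> c" "c \<le> m i" "m j < m i" using I_gt[OF that(1)] J_le[OF that(2)] by auto
  qed
  note event = event_prob_two_point_vector[OF A, of m c]
  consider (full) "A = \<Omega>"
    | (up) "A \<noteq> \<Omega>" "c \<noteq> m s \<and> I \<subseteq> A \<or> c = m s \<and> I \<union> {s} \<subseteq> A"
    | (down) "A \<noteq> \<Omega>" "\<not> (c \<noteq> m s \<and> I \<subseteq> A \<or> c = m s \<and> I \<union> {s} \<subseteq> A)" "J \<subseteq> A"
    | (zero) "A \<noteq> \<Omega>" "\<not> (c \<noteq> m s \<and> I \<subseteq> A \<or> c = m s \<and> I \<union> {s} \<subseteq> A)" "\<not> J \<subseteq> A"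
    by blast
  then show ?thesis
  proof cases
    case full
    show ?thesis
      \<comment> \<open>Every vector of the polytope has total mass 1, so any of them, here
        \<open>p\<close>, is a minimiser.\<close>
      using full attained[of p 1] p(1) assms(2)
      by (auto simp: martingale_vectors_def event_prob_def)
  next
    case up
    define j where "j = Min {j \<in> J. j \<notin> A}"
    have "{j \<in> J. j \<notin> A} \<noteq> {}" using up IJ A assms(2) by blast
    moreover have "finite {j \<in> J. j \<notin> A}" using assms(15) by simp
    ultimately have j: "j \<in> J" "j \<notin> A" and j_le: "\<And>k. k \<in> J \<Longrightarrow> k \<notin> A \<Longrightarrow> j \<le> k"
      using Min_in[of "{j \<in> J. j \<notin> A}"] by (auto simp: j_def)
    have "I \<subseteq> A" using up by blast
    have jn: "j \<in> {1..n}" using j IJ by blast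
    have mj: "m j < m 1" using J_le[OF j(1)] c1 by simp
    \<comment> \<open>Since \<open>I \<subseteq> A\<close>, the states outside \<open>A\<close> lie
      in \<open>J\<close>. As \<open>m\<close> decreases, the first of them, \<open>j\<close>,
      carries the largest value of \<open>m\<close> off \<open>A\<close>, while state 1 carries the
      largest on \<open>A\<close>.\<close>
    have "(c - m j) / (m 1 - m j) \<le> event_prob q A" if "q \<in> martingale_vectors n m c" for q
    proof (rule event_prob_ge_upper[OF that A mj])
      show "m i \<le> m 1" if "i \<in> A" for i using that A \<open>n > 2\<close> by (intro m_le) auto
      show "m i \<le> m j" if "i \<in> {1..n} - A" for i
        using that j_le jn IJ \<open>I \<subseteq> A\<close> by (intro m_le) blast+
    qed
    moreover have "event_prob (two_point_vector n m c 1 j) A = (c - m j) / (m 1 - m j)"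
      using event j \<open>1 \<in> I\<close> \<open>I \<subseteq> A\<close> by auto
    ultimately show ?thesis
      using attained[OF two_point[OF \<open>1 \<in> I\<close> j(1)]] up
      unfolding c_def j_def by (simp add: Let_def)
  next
    case down
    define i where "i = Max {i \<in> I. i \<notin> A}"
    have "{i \<in> I. i \<notin> A} \<noteq> {}" using down(1,3) IJ A assms(2) by blast
    moreover have "finite {i \<in> I. i \<notin> A}" using assms(14) by simp
    ultimately have i: "i \<in> I" "i \<notin> A" and i_ge: "\<And>k. k \<in> I \<Longrightarrow> k \<notin> A \<Longrightarrow> k \<le> i"
      using Max_in[of "{i \<in> I. i \<notin> A}"] by (auto simp: i_def)
    have i_in: "i \<in> {1..n}" using i IJ by blast
    have mi: "m n < m i" using I_gt[OF i(1)] cn by simp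
    \<comment> \<open>Dually, the states outside \<open>A\<close> lie in \<open>I\<close>; the last
      of them, \<open>i\<close>, has the smallest value of \<open>m\<close> off \<open>A\<close>,
      and state \<open>n\<close> has the smallest on \<open>A\<close>.\<close>
    have "(m i - c) / (m i - m n) \<le> event_prob q A" if "q \<in> martingale_vectors n m c" for q
    proof (rule event_prob_ge_lower[OF that A mi])
      show "m n \<le> m k" if "k \<in> A" for k using that A \<open>n > 2\<close> by (intro m_le) auto
      show "m i \<le> m k" if "k \<in> {1..n} - A" for k
        using that i_ge i_in IJ \<open>J \<subseteq> A\<close> by (intro m_le) blast+
    qed
    moreover have "event_prob (two_point_vector n m c i n) A = (m i - c) / (m i - m n)"
      using event i \<open>n \<in> J\<close> \<open>J \<subseteq> A\<close> by auto
    ultimately show ?thesis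
      using attained[OF two_point[OF i(1) \<open>n \<in> J\<close>]] down
      unfolding c_def i_def by (auto simp: Let_def)
  next
    case zero
    have "\<exists>i\<in>I. \<exists>j\<in>J. event_prob (two_point_vector n m c i j) A = 0"
    proof (cases "c = m s \<and> s \<notin> A")
      case True
      \<comment> \<open>With \<open>c = m s\<close> the weight at state 1 vanishes, so the vector is
        the point mass at \<open>s\<close>, which lies outside \<open>A\<close> even if
        \<open>I \<subseteq> A\<close>.\<close>
      then have "event_prob (two_point_vector n m c 1 s) A = 0" using event by auto
      then show ?thesis using \<open>1 \<in> I\<close> \<open>s \<in> J\<close> by blast
    next
      case False
      \<comment> \<open>Now neither \<open>I\<close> nor \<open>J\<close> is contained in
        \<open>A\<close>: if \<open>c = m s\<close>, then \<open>s \<in> A\<close>, so the excluded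
        inclusion of \<open>I \<union> {s}\<close> must fail within \<open>I\<close>. Both support
        points can thus be chosen outside \<open>A\<close>.\<close>
      then obtain i j where "i \<in> I" "i \<notin> A" "j \<in> J" "j \<notin> A" using zero by blast
      moreover from this have "event_prob (two_point_vector n m c i j) A = 0" using event by simp
      ultimately show ?thesis by blast
    qed
    then obtain i j where "i \<in> I" "j \<in> J" "event_prob (two_point_vector n m c i j) A = 0" by blast
    moreover have "0 \<le> event_prob q A" if "q \<in> martingale_vectors n m c" for q
      unfolding event_prob_def using that A by (intro sum_nonneg) (auto simp: martingale_vectors_def)
    ultimately show ?thesis
      using attained[OF two_point] zero unfolding c_def by auto
  qed
qed

end
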